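(* Let $(\lambda_2,\ldots,\lambda_n)$ be any list of non-positive real numbers such that $0\ge\lambda_2\ge\cdots\ge\lambda_n$. Then there exists a least real number $\lambda_0$ with $$\max_{2\le j\le n}|\lambda_j|\le\lambda_0\le (n-1)|\lambda_n|$$ such that the list $(\lambda_1;\lambda_2,\ldots,\lambda_n)$ is realizable by an $n\times n$ nonnegative generalized doubly stochastic matrix if and only if $\lambda_1\ge\lambda_0$.
   Context: Lists are considered with multiplicity. A real $n\times n$ matrix is generalized doubly stochastic if there is a real number $r\ge 0$ such that every row sum and every column sum equals $r$; it is nonnegative if all its entries are nonnegative. A list $(\lambda_1;\lambda_2,\ldots,\lambda_n)$, with a semicolon after the first entry, is realizable by a nonnegative matrix $A$ if it is the spectrum of $A$ (eigenvalues counted with multiplicity) and $\lambda_1$ is the Perron eigenvalue of $A$ (the nonnegative eigenvalue that is at least the modulus of every other eigenvalue). *)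

theory Defs
  imports "Jordan_Normal_Form.Spectral_Radius" "HOL-Computational_Algebra.Polynomial"
begin

definition nonneg_matrix :: "real mat \<Rightarrow> bool" where
  "nonneg_matrix A \<longleftrightarrow> (\<forall>i < dim_row A. \<forall>j < dim_col A. A $$ (i, j) \<ge> 0)"

definition gen_doubly_stochastic :: "real mat \<Rightarrow> bool" where
  "gen_doubly_stochastic A \<longleftrightarrow> square_mat A \<and>
     (\<exists>r\<ge>0. (\<forall>i < dim_row A. (\<Sum>j < dim_col A. A $$ (i, j)) = r) \<and>
            (\<forall>j < dim_col A. (\<Sum>i < dim_row A. A $$ (i, j)) = r))"

text \<open>The spectrum of a real square matrix is taken over the complex numbers, as the multiset
  of roots of the characteristic polynomial.\<close>

definition spectrum_mset :: "real mat \<Rightarrow> complex multiset" where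
  "spectrum_mset A = proots (char_poly (map_mat complex_of_real A))"

definition perron_eigenvalue :: "real mat \<Rightarrow> real \<Rightarrow> bool" where
  "perron_eigenvalue A r \<longleftrightarrow> r \<ge> 0 \<and>
     eigenvalue (map_mat complex_of_real A) (complex_of_real r) \<and>
     (\<forall>z. eigenvalue (map_mat complex_of_real A) z \<longrightarrow> cmod z \<le> r)"

text \<open>\<open>realizable_by l ls A\<close>: the list \<open>(l; ls)\<close>, whose first entry \<open>l\<close> is distinguished, is
  realizable by the nonnegative matrix \<open>A\<close>.\<close>

definition realizable_by :: "real \<Rightarrow> complex list \<Rightarrow> real mat \<Rightarrow> bool" where
  "realizable_by l ls A \<longleftrightarrow> square_mat A \<and> nonneg_matrix A \<and>
     spectrum_mset A = mset (complex_of_real l # ls) \<and> perron_eigenvalue A l"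

definition is_least :: "real \<Rightarrow> real set \<Rightarrow> bool" where
  "is_least x S \<longleftrightarrow> x \<in> S \<and> (\<forall>y\<in>S. x \<le> y)"

end

(*
  Let R be the set of admissible Perron eigenvalues.  A reflection H with first column
  (1,...,1)/sqrt n makes H A H block triangular when A has constant row sums r, and adding t/n to
  every entry of A only changes the corner from r to r + t; hence R is upward closed.  Fixing the
  characteristic polynomial is a closed condition on the entries, so compactness yields a least
  element of R.  Finally (n - 1)|lambda_n| lies in R, witnessed by
  H diag((n - 1)|lambda_n|, lambda_2, ..., lambda_n) H: the orthonormality of the rows of H and
  AM-GM bound its entries from below by 0.
*)

theory Submission
  imports Defs "HOL-Analysis.Function_Topology"
begin

definition doubly_stochastic :: "nat \<Rightarrow> real \<Rightarrow> real mat \<Rightarrow> bool" where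
  "doubly_stochastic n r A \<longleftrightarrow> A \<in> carrier_mat n n \<and> nonneg_matrix A \<and>
     (\<forall>i<n. (\<Sum>j<n. A $$ (i, j)) = r) \<and> (\<forall>j<n. (\<Sum>i<n. A $$ (i, j)) = r)"

text \<open>Real counterpart of realizability: an identity between real characteristic polynomials
  replaces the complex spectrum, the line sum is tied to \<open>r\<close>, and the modulus bound on
  \<open>ds\<close> stands for the Perron property. That \<open>r\<close> is nonnegative follows
  from the row sums.\<close>

definition ds_realizable :: "real list \<Rightarrow> real \<Rightarrow> bool" where
  "ds_realizable ds r \<longleftrightarrow> (\<forall>d\<in>set ds. \<bar>d\<bar> \<le> r) \<and>
     (\<exists>A. doubly_stochastic (Suc (length ds)) r A \<and> char_poly A = (\<Prod>d\<leftarrow>r # ds. [:- d, 1:]))"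

section \<open>A symmetric orthogonal matrix with constant first column\<close>

lemma sum_mult_delta_shift:
  fixes c :: real
  assumes "i < n" "k < n"
  shows "(\<Sum>j<n. ((if i = j then 1 else 0) - c) * ((if j = k then 1 else 0) - c))
    = (if i = k then 1 else 0) - 2 * c + real n * c\<^sup>2"
proof -
  have "(\<Sum>j<n. ((if i = j then 1 else 0) - c) * ((if j = k then 1 else 0) - c))
    = (\<Sum>j<n. (if j = i then (if i = k then 1 else 0) else 0) - c * (if j = i then 1 else 0)
          - c * (if j = k then 1 else 0) + c\<^sup>2)"
    by (rule sum.cong) (auto simp: algebra_simps power2_eq_square)
  also have "\<dots> = (if i = k then 1 else 0) - 2 * c + real n * c\<^sup>2"
    using assms by (simp add: sum.distrib sum_subtractf sum_distrib_left [symmetric])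
  finally show ?thesis .
qed

text \<open>The reflection exchanging the first unit vector and the normalized all-ones vector.\<close>

lemma householder_ones:
  fixes n :: nat
  assumes "n > 0"
  obtains H :: "real mat" where "H \<in> carrier_mat n n" "H * H = 1\<^sub>m n"
    "\<And>i j. i < n \<Longrightarrow> j < n \<Longrightarrow> H $$ (i, j) = H $$ (j, i)"
    "\<And>i. i < n \<Longrightarrow> H $$ (i, 0) = 1 / sqrt n"
proof -
  obtain m where n: "n = Suc m" using assms gr0_implies_Suc by blast
  define s where "s = sqrt n"
  have s2: "s * s = 1 + real m" by (simp add: s_def n)
  have s0: "s > 0" using assms by (simp add: s_def)
  \<comment> \<open>Householder matrix I - 2 v v^T / (v^T v) for v = e_0 - (1,...,1)/s: as v^T v = 2
    - 2/s, its lower block is the identity minus \<open>c\<close> in every entry. For n = 1 the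
    division by zero gives 0, but that block is empty; hence the \<open>m > 0\<close> guards
    below.\<close>
  define c where "c = 1 / (s * (s - 1))"
  define h :: "nat \<times> nat \<Rightarrow> real"
    where "h = (\<lambda>(i, j). if i = 0 \<or> j = 0 then 1 / s else (if i = j then 1 else 0) - c)"
  define H where "H = mat n n h"
  have s1: "s > 1" if "m > 0"
    using that by (simp add: s_def n)
  have mc: "m * c = (s + 1) / s" if "m > 0"
  proof -
    have "real m = (s + 1) * (s - 1)" using s2 by (simp add: algebra_simps)
    then show ?thesis using s1 [OF that] by (simp add: c_def)
  qed
  \<comment> \<open>The later columns are orthogonal to the all-ones vector; this settles both mixed
    cases of \<open>HH\<close>.\<close>
  have col: "(\<Sum>j<n. h (j, k)) = 0" if "0 < k" "k < n" for k
  proof -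
    obtain k' where k: "k = Suc k'" using \<open>0 < k\<close> gr0_implies_Suc by blast
    have "(\<Sum>j<n. h (j, k)) = 1 / s + 1 - m * c"
      using that unfolding n sum.lessThan_Suc_shift
      by (simp add: h_def k sum_subtractf)
    also have "\<dots> = 0" using mc that n s0 by (simp add: field_simps)
    finally show ?thesis .
  qed
  have HH: "(\<Sum>j<n. h (i, j) * h (j, k)) = (if i = k then 1 else 0)" if "i < n" "k < n" for i k
  proof -
    have sym: "h (i, j) = h (j, i)" for i j by (simp add: h_def)
    consider "i = 0" "k = 0" | "i = 0" "k > 0" | "i > 0" "k = 0" | "i > 0" "k > 0" by auto
    then show ?thesis
    proof cases
      case 1
      then show ?thesis using s2 s0 by (simp add: h_def n field_simps)
    next
      case 2
      then have "(\<Sum>j<n. h (i, j) * h (j, k)) = 1 / s * (\<Sum>j<n. h (j, k))"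
        by (simp add: h_def sum_distrib_left)
      with 2 col that show ?thesis by simp
    next
      case 3
      then have "(\<Sum>j<n. h (i, j) * h (j, k)) = 1 / s * (\<Sum>j<n. h (j, i))"
        by (simp add: sym [of i] sum_distrib_left) (simp add: h_def)
      with 3 col that show ?thesis by simp
    next
      case 4
      then obtain i' k' where ik: "i = Suc i'" "k = Suc k'" by (metis gr0_implies_Suc)
      have m: "m > 0" using 4 that n by simp
      have "(\<Sum>j<n. h (i, j) * h (j, k)) = 1 / (s * s) +
         (\<Sum>j<m. ((if i' = j then 1 else 0) - c) * ((if j = k' then 1 else 0) - c))"
        unfolding n sum.lessThan_Suc_shift by (simp add: h_def ik)
      also have "\<dots> = (if i = k then 1 else 0) + (1 / (s * s) - 2 * c + (m * c) * c)"
        using that n ik by (subst sum_mult_delta_shift) (auto simp: power2_eq_square)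
      \<comment> \<open>By \<open>mc\<close> the last two terms combine to
        \<open>c * (1 - s) / s\<close>, which is \<open>- 1 / (s * s)\<close>.\<close>
      also have "1 / (s * s) - 2 * c + (m * c) * c = 0"
        unfolding mc [OF m] using s1 [OF m] by (simp add: c_def divide_simps)
      finally show ?thesis by simp
    qed
  qed
  show thesis
  proof (rule that)
    show "H \<in> carrier_mat n n" by (simp add: H_def)
    show "H * H = 1\<^sub>m n"
      by (rule eq_matI)
        (auto simp: H_def scalar_prod_def HH [symmetric] lessThan_atLeast0 intro!: sum.cong)
    show "H $$ (i, j) = H $$ (j, i)" if "i < n" "j < n" for i j
      using that by (simp add: H_def h_def)
    show "H $$ (i, 0) = 1 / sqrt n" if "i < n" for i
      using that by (simp add: H_def h_def s_def)
  qed
qed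

section \<open>Rank-one perturbation and upward closure\<close>

lemma index_mult_mat_sum:
  assumes "A \<in> carrier_mat n m" "B \<in> carrier_mat m p" "i < n" "j < p"
  shows "(A * B) $$ (i, j) = (\<Sum>k<m. A $$ (i, k) * B $$ (k, j))"
  using assms by (auto simp: scalar_prod_def lessThan_atLeast0 intro!: sum.cong)

text \<open>Brauer's rank-one perturbation, for the all-ones eigenvector.\<close>

lemma char_poly_add_const:
  fixes A :: "real mat"
  assumes A: "A \<in> carrier_mat n n" and n: "n > 0"
    and row: "\<And>i. i < n \<Longrightarrow> (\<Sum>j<n. A $$ (i, j)) = r"
  shows "\<exists>q. char_poly A = [:- r, 1:] * q \<and>
    (\<forall>t. char_poly (A + mat n n (\<lambda>_. t / real n)) = [:- (r + t), 1:] * q)"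
proof -
  obtain H :: "real mat" where H: "H \<in> carrier_mat n n" and HH: "H * H = 1\<^sub>m n"
    and sym: "\<And>i j. i < n \<Longrightarrow> j < n \<Longrightarrow> H $$ (i, j) = H $$ (j, i)"
    and H0: "\<And>i. i < n \<Longrightarrow> H $$ (i, 0) = 1 / sqrt n"
    using householder_ones [OF n] by blast
  obtain m where m: "n = Suc m" using n gr0_implies_Suc by blast
  \<comment> \<open>Column 0 of \<open>H\<close> is constant, so column 0 of \<open>H * H\<close>
    consists of the row sums of \<open>H\<close> scaled by \<open>1 / sqrt n\<close>, while it must
    be the first unit vector.\<close>
  have rowH: "(\<Sum>k<n. H $$ (i, k)) = (if i = 0 then sqrt n else 0)" if "i < n" for i
  proof -
    have "(if i = 0 then 1 else 0) = (H * H) $$ (i, 0)" using that n by (simp add: HH)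
    also have "\<dots> = (\<Sum>k<n. H $$ (i, k)) / sqrt n"
      unfolding index_mult_mat_sum [OF H H that n] using H0 by (simp add: sum_divide_distrib)
    finally show ?thesis using n by (simp split: if_splits)
  qed
  have colH: "(\<Sum>k<n. H $$ (k, j)) = (if j = 0 then sqrt n else 0)" if "j < n" for j
    using rowH [OF that] sym that by (metis (no_types, lifting) lessThan_iff sum.cong)
  \<comment> \<open>This block is built from \<open>A\<close> alone, so its characteristic
    polynomial can serve as one cofactor \<open>q\<close> for all \<open>t\<close>.\<close>
  define C where "C = mat m m (\<lambda>(i, j). (H * (A * H)) $$ (Suc i, Suc j))"
  have *: "char_poly (A + mat n n (\<lambda>_. t / real n)) = [:- (r + t), 1:] * char_poly C" for t
  proof -
    define X where "X = A + mat n n (\<lambda>_. t / real n)"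
    have X: "X \<in> carrier_mat n n" using A by (simp add: X_def)
    define Y where "Y = H * (X * H)"
    have Y: "Y \<in> carrier_mat n n" using H X by (simp add: Y_def)
    have rowX: "(\<Sum>j<n. X $$ (i, j)) = r + t" if "i < n" for i
      using that A n row [OF that] by (simp add: X_def sum.distrib)
    \<comment> \<open>\<open>H\<close> sends e_0 to the normalized all-ones vector, \<open>X\<close>
      scales that by \<open>r + t\<close>, and \<open>H\<close> sends it back to e_0.\<close>
    have Y0: "Y $$ (i, 0) = (if i = 0 then r + t else 0)" if "i < n" for i
    proof -
      have *: "(X * H) $$ (k, 0) = (r + t) / sqrt n" if "k < n" for k
        unfolding index_mult_mat_sum [OF X H that n]
        using rowX [OF that] H0 by (simp add: sum_divide_distrib [symmetric])
      have "Y $$ (i, 0) = (\<Sum>k<n. H $$ (i, k)) * ((r + t) / sqrt n)"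
        unfolding Y_def using H X n that
        by (subst index_mult_mat_sum [of _ n n _ n])
          (auto simp: * sum_distrib_right sum_divide_distrib simp del: index_mult_mat)
      then show ?thesis using rowH [OF that] n by simp
    qed
    \<comment> \<open>The perturbation multiplies column sums of \<open>H\<close> by
      \<open>t / n\<close>, and these vanish for every column but the first.\<close>
    have YS: "Y $$ (i, j) = (H * (A * H)) $$ (i, j)" if "i < n" "j < n" "0 < j" for i j
    proof -
      have "(X * H) $$ (k, j) = (A * H) $$ (k, j)" if "k < n" for k
      proof -
        have "(X * H) $$ (k, j) = (\<Sum>l<n. A $$ (k, l) * H $$ (l, j) + t / n * H $$ (l, j))"
          unfolding index_mult_mat_sum [OF X H that \<open>j < n\<close>]
          using that A by (intro sum.cong) (auto simp: X_def ring_distribs)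
        also have "\<dots> = (A * H) $$ (k, j) + (\<Sum>l<n. t / n * H $$ (l, j))"
          unfolding index_mult_mat_sum [OF A H that \<open>j < n\<close>] by (rule sum.distrib)
        also have "(\<Sum>l<n. t / n * H $$ (l, j)) = t / n * (\<Sum>l<n. H $$ (l, j))"
          by (rule sum_distrib_left [symmetric])
        also have "\<dots> = 0" using colH [OF \<open>j < n\<close>] \<open>0 < j\<close> by simp
        finally show ?thesis by simp
      qed
      moreover have "X * H \<in> carrier_mat n n" "A * H \<in> carrier_mat n n" using H X A by auto
      ultimately show ?thesis
        unfolding Y_def using index_mult_mat_sum [OF H] that by (simp del: index_mult_mat)
    qed
    define Y1 where "Y1 = mat 1 1 (\<lambda>_. r + t)"
    define Y2 where "Y2 = mat 1 m (\<lambda>(i, j). Y $$ (i, Suc j))"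
    have Y4: "Y = four_block_mat Y1 Y2 (0\<^sub>m m 1) C"
    proof (rule eq_matI)
      show "dim_row Y = dim_row (four_block_mat Y1 Y2 (0\<^sub>m m 1) C)"
        "dim_col Y = dim_col (four_block_mat Y1 Y2 (0\<^sub>m m 1) C)"
        using Y by (auto simp: m Y1_def C_def)
      fix i j
      assume "i < dim_row (four_block_mat Y1 Y2 (0\<^sub>m m 1) C)"
        "j < dim_col (four_block_mat Y1 Y2 (0\<^sub>m m 1) C)"
      then have ij: "i < n" "j < n" by (auto simp: m Y1_def C_def)
      then show "Y $$ (i, j) = four_block_mat Y1 Y2 (0\<^sub>m m 1) C $$ (i, j)"
        using Y0 [of i] YS [of i j]
        by (cases i; cases j) (auto simp: m Y1_def Y2_def C_def)
    qed
    have "similar_mat X Y"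
    proof (rule similar_matI [of _ _ H H n])
      have "H * Y * H = (H * H) * X * (H * H)"
        unfolding Y_def using H X by (simp add: assoc_mult_mat [of _ n n _ n _ n])
      then show "X = H * Y * H" using X by (simp add: HH)
    qed (use H X Y HH in auto)
    then have "char_poly X = char_poly Y" by (rule char_poly_similar)
    also have "\<dots> = char_poly Y1 * char_poly C"
      unfolding Y4 by (rule char_poly_four_block_zeros_col) (auto simp: Y1_def Y2_def C_def)
    also have "char_poly Y1 = [:- (r + t), 1:]"
      by (simp add: Y1_def char_poly_defs det_def sign_def)
    finally show ?thesis by (simp add: X_def)
  qed
  \<comment> \<open>The case \<open>t = 0\<close> gives the factorization of \<open>A\<close> itself
    with the same cofactor.\<close>
  have "A + mat n n (\<lambda>_. 0 / real n) = A" using A by (intro eq_matI) auto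
  with * [of 0] have "char_poly A = [:- r, 1:] * char_poly C" by simp
  with * show ?thesis by blast
qed

lemma doubly_stochastic_nonneg:
  assumes "doubly_stochastic n r A" "n > 0"
  shows "r \<ge> 0"
proof -
  have "r = (\<Sum>j<n. A $$ (0, j))" using assms by (simp add: doubly_stochastic_def)
  also have "\<dots> \<ge> 0"
    using assms by (intro sum_nonneg) (auto simp: doubly_stochastic_def nonneg_matrix_def)
  finally show ?thesis .
qed

text \<open>Spreading \<open>r' - r\<close> evenly over all entries preserves nonnegativity and
  raises each line sum to \<open>r'\<close>; by the rank-one perturbation only the root
  \<open>r\<close> moves.\<close>

lemma ds_realizable_mono:
  assumes "ds_realizable ds r" "r \<le> r'"
  shows "ds_realizable ds r'"
proof -
  define n where "n = Suc (length ds)"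
  have n: "n > 0" by (simp add: n_def)
  obtain A where A: "doubly_stochastic n r A"
    and cp: "char_poly A = (\<Prod>d\<leftarrow>r # ds. [:- d, 1:])"
    using assms(1) unfolding ds_realizable_def n_def by blast
  have Ac: "A \<in> carrier_mat n n" using A by (simp add: doubly_stochastic_def)
  have row: "\<And>i. i < n \<Longrightarrow> (\<Sum>j<n. A $$ (i, j)) = r"
    using A by (simp add: doubly_stochastic_def)
  obtain q where q0: "char_poly A = [:- r, 1:] * q"
    and q: "\<And>t. char_poly (A + mat n n (\<lambda>_. t / real n)) = [:- (r + t), 1:] * q"
    using char_poly_add_const [OF Ac n row] by blast
  have "[:- r, 1:] * q = [:- r, 1:] * (\<Prod>d\<leftarrow>ds. [:- d, 1:])"
    using q0 cp by simp
  \<comment> \<open>Polynomials over the reals form a domain, so the linear factor cancels even when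
    \<open>r\<close> also occurs in \<open>ds\<close>.\<close>
  then have "q = (\<Prod>d\<leftarrow>ds. [:- d, 1:])" by (subst (asm) mult_cancel_left) auto
  then have "char_poly (A + mat n n (\<lambda>_. (r' - r) / real n)) = (\<Prod>d\<leftarrow>r' # ds. [:- d, 1:])"
    using q [of "r' - r"] by simp
  moreover have "doubly_stochastic n r' (A + mat n n (\<lambda>_. (r' - r) / real n))"
    using A assms(2) n unfolding doubly_stochastic_def nonneg_matrix_def
    by (auto simp: sum.distrib)
  ultimately show ?thesis
    using assms unfolding ds_realizable_def n_def by (meson order_trans)
qed

section \<open>Realizability at the upper bound\<close>

lemma ds_realizable_upper:
  assumes "\<And>d. d \<in> set ds \<Longrightarrow> - \<mu> \<le> d \<and> d \<le> 0" and "ds \<noteq> []"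
  shows "ds_realizable ds (real (length ds) * \<mu>)"
proof -
  define m where "m = length ds"
  define n where "n = Suc m"
  define r where "r = real m * \<mu>"
  define e where "e = r # ds"
  have n: "n > 0" and len: "length e = n" by (simp_all add: n_def e_def m_def)
  have mu: "0 \<le> \<mu>" using assms by (metis list.set_sel(1) neg_le_0_iff_le order_trans)
  obtain H :: "real mat" where H: "H \<in> carrier_mat n n" and HH: "H * H = 1\<^sub>m n"
    and sym: "\<And>i j. i < n \<Longrightarrow> j < n \<Longrightarrow> H $$ (i, j) = H $$ (j, i)"
    and H0: "\<And>i. i < n \<Longrightarrow> H $$ (i, 0) = 1 / sqrt n"
    using householder_ones [OF n] by blast
  define D where "D = mat n n (\<lambda>(i, j). if i = j then e ! i else 0)"
  have D: "D \<in> carrier_mat n n" by (simp add: D_def)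
  define A where "A = H * D * H"
  have A: "A \<in> carrier_mat n n" using H D by (simp add: A_def)
  have HHs: "(\<Sum>k<n. H $$ (i, k) * H $$ (k, j)) = (if i = j then 1 else 0)" if "i < n" "j < n" for i j
    using index_mult_mat_sum [OF H H that] that by (simp add: HH)
  have HD: "(H * D) $$ (i, k) = H $$ (i, k) * e ! k" if "i < n" "k < n" for i k
    unfolding index_mult_mat_sum [OF H D that]
    using that by (simp add: D_def if_distrib [of "\<lambda>x. _ * x"] cong: if_cong)
  have Aij: "A $$ (i, j) = (\<Sum>k<n. H $$ (i, k) * e ! k * H $$ (k, j))" if "i < n" "j < n" for i j
    unfolding A_def using H D that
    by (subst index_mult_mat_sum [of _ n n _ n]) (auto simp: HD simp del: index_mult_mat intro!: sum.cong)
  have Asym: "A $$ (i, j) = A $$ (j, i)" if "i < n" "j < n" for i j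
    unfolding Aij [OF that] Aij [OF that(2,1)] using sym that by (auto intro!: sum.cong)
  have colH: "(\<Sum>j<n. H $$ (k, j)) = (if k = 0 then sqrt n else 0)" if "k < n" for k
  proof -
    have "(if k = 0 then 1 else 0) = (\<Sum>j<n. H $$ (k, j)) / sqrt n"
      using HHs [OF that n] H0 by (simp add: sum_divide_distrib)
    then show ?thesis using n by (simp split: if_splits)
  qed
  have row: "(\<Sum>j<n. A $$ (i, j)) = r" if "i < n" for i
  proof -
    \<comment> \<open>After swapping the sums only \<open>k = 0\<close> survives, since the other
      rows of \<open>H\<close> sum to zero.\<close>
    have "(\<Sum>j<n. A $$ (i, j)) = (\<Sum>k<n. H $$ (i, k) * e ! k * (\<Sum>j<n. H $$ (k, j)))"
      using that by (simp add: Aij sum_distrib_left) (rule sum.swap)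
    also have "\<dots> = (\<Sum>k<n. if k = 0 then H $$ (i, 0) * e ! 0 * sqrt n else 0)"
      by (rule sum.cong) (auto simp: colH)
    also have "\<dots> = r" using n H0 [OF that] by (simp add: e_def)
    finally show ?thesis .
  qed
  have nn: "A $$ (i, j) \<ge> 0" if "i < n" "j < n" for i j
  proof -
    \<comment> \<open>Rows of \<open>H\<close> are unit vectors, and the entry in column 0 accounts
      for 1/n of the squared norm.\<close>
    have sq: "(\<Sum>k<m. (H $$ (i, Suc k))\<^sup>2) = 1 - 1 / n" if "i < n" for i
    proof -
      have "(\<Sum>k<n. H $$ (i, k) * H $$ (i, k)) = (\<Sum>k<n. H $$ (i, k) * H $$ (k, i))"
        using sym that by (auto intro!: sum.cong)
      then have "(\<Sum>k<n. (H $$ (i, k))\<^sup>2) = 1" using HHs [OF that that] by (simp add: power2_eq_square)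
      then show ?thesis
        using H0 [OF that] unfolding n_def sum.lessThan_Suc_shift by (simp add: power_divide)
    qed
    \<comment> \<open>With \<open>d\<close> the negated eigenvalue the term is -d x y; bound x y by
      (x^2 + y^2)/2, then \<open>d\<close> by \<mu>.\<close>
    have "- \<mu> * (((H $$ (i, Suc k))\<^sup>2 + (H $$ (j, Suc k))\<^sup>2) / 2)
        \<le> H $$ (i, Suc k) * e ! Suc k * H $$ (Suc k, j)" if "k < m" for k
    proof -
      define x where "x = H $$ (i, Suc k)"
      define y where "y = H $$ (j, Suc k)"
      define d where "d = - ds ! k"
      have "ds ! k \<in> set ds" using that by (simp add: m_def)
      then have d: "0 \<le> d" "d \<le> \<mu>" using assms(1) by (fastforce simp: d_def)+
      have "d * (x * y) \<le> d * ((x\<^sup>2 + y\<^sup>2) / 2)"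
        using d sum_squares_bound [of x y] by (intro mult_left_mono) auto
      also have "\<dots> \<le> \<mu> * ((x\<^sup>2 + y\<^sup>2) / 2)"
        using d by (intro mult_right_mono) auto
      finally show ?thesis
        using sym [of "Suc k" j] that \<open>j < n\<close> by (simp add: x_def y_def d_def e_def n_def mult_ac)
    qed
    then have "(\<Sum>k<m. - \<mu> * (((H $$ (i, Suc k))\<^sup>2 + (H $$ (j, Suc k))\<^sup>2) / 2))
        \<le> (\<Sum>k<m. H $$ (i, Suc k) * e ! Suc k * H $$ (Suc k, j))"
      by (intro sum_mono) auto
    also have "(\<Sum>k<m. - \<mu> * (((H $$ (i, Suc k))\<^sup>2 + (H $$ (j, Suc k))\<^sup>2) / 2)) = - \<mu> * (1 - 1 / n)"
      unfolding sum_distrib_left [symmetric] sum_divide_distrib [symmetric] sum.distrib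
      by (simp add: sq that)
    also have "(\<Sum>k<m. H $$ (i, Suc k) * e ! Suc k * H $$ (Suc k, j))
        = A $$ (i, j) - H $$ (i, 0) * e ! 0 * H $$ (0, j)"
      unfolding Aij [OF that] unfolding n_def sum.lessThan_Suc_shift by simp
    also have "H $$ (i, 0) * e ! 0 * H $$ (0, j) = r / n"
      using H0 that sym [of 0 j] n by (simp add: e_def)
    \<comment> \<open>The factor \<open>length ds\<close> in \<open>r\<close> is chosen for this
      equality: the Perron term exactly offsets the lower bound for the remaining terms.\<close>
    also have "r / n = \<mu> * (1 - 1 / n)"
      by (simp add: r_def n_def field_simps)
    finally show ?thesis by simp
  qed
  have col: "(\<Sum>i<n. A $$ (i, j)) = r" if "j < n" for j
  proof -
    have "(\<Sum>i<n. A $$ (i, j)) = (\<Sum>i<n. A $$ (j, i))"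
      by (intro sum.cong refl Asym) (use that in auto)
    with row [OF that] show ?thesis by simp
  qed
  have "doubly_stochastic n r A"
    using A nn row col by (simp add: doubly_stochastic_def nonneg_matrix_def)
  moreover have "char_poly A = (\<Prod>d\<leftarrow>e. [:- d, 1:])"
  proof -
    have "similar_mat A D"
      by (rule similar_matI [of _ _ H H n]) (use H D A HH A_def in auto)
    then have "char_poly A = char_poly D" by (rule char_poly_similar)
    also have "\<dots> = (\<Prod>d\<leftarrow>diag_mat D. [:- d, 1:])"
      by (rule char_poly_upper_triangular [OF D]) (auto simp: D_def)
    also have "diag_mat D = e"
      by (rule nth_equalityI) (auto simp: diag_mat_def D_def len)
    finally show ?thesis .
  qed
  moreover have "\<bar>d\<bar> \<le> r" if "d \<in> set ds" for d
  proof -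
    have "\<bar>d\<bar> \<le> \<mu>" using assms(1) [OF that] by linarith
    also have "\<mu> = 1 * \<mu>" by simp
    also have "\<dots> \<le> r" unfolding r_def using that mu
      by (intro mult_right_mono) (auto simp: m_def Suc_le_eq)
    finally show ?thesis .
  qed
  ultimately show ?thesis
    unfolding ds_realizable_def e_def r_def n_def m_def by blast
qed

section \<open>Compactness and the least realizable value\<close>

lemma continuous_on_det_mat:
  fixes f :: "'a::topological_space \<Rightarrow> nat \<times> nat \<Rightarrow> real"
  assumes "\<And>p. continuous_on S (\<lambda>x. f x p)"
  shows "continuous_on S (\<lambda>x. det (mat n n (f x)))"
proof -
  have "det (mat n n (f x)) = (\<Sum>p | p permutes {0..<n}. signof p * (\<Prod>i = 0..<n. f x (i, p i)))" for x
    by (subst det_def' [of _ n]) (auto intro!: sum.cong prod.cong simp: permutes_in_image)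
  then show ?thesis by (auto intro!: continuous_intros assms)
qed

text \<open>Evaluation at \<open>z\<close> is a ring homomorphism and commutes with the determinant.
  This turns a condition on the characteristic polynomial into scalar equations, one per
  \<open>z\<close>, that are visibly closed in the entries.\<close>

lemma poly_char_poly_det:
  fixes A :: "'a::comm_ring_1 mat"
  assumes "A \<in> carrier_mat n n"
  shows "poly (char_poly A) z = det (mat n n (\<lambda>(i, j). (if i = j then z else 0) - A $$ (i, j)))"
proof -
  have hom: "comm_ring_hom (\<lambda>p::'a poly. poly p z)" by unfold_locales auto
  have "map_mat (\<lambda>p. poly p z) (char_poly_matrix A) = mat n n (\<lambda>(i, j). (if i = j then z else 0) - A $$ (i, j))"
    using assms by (intro eq_matI) (auto simp: char_poly_matrix_def)
  then show ?thesis unfolding char_poly_def by (simp flip: comm_ring_hom.hom_det [OF hom])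
qed

text \<open>Matrices realizing values up to \<open>b\<close> have entries in [0, b] and satisfy
  closed conditions, so they form a compact set, on which the continuous line sum attains its
  minimum.\<close>

lemma ds_realizable_least:
  assumes "ds_realizable ds b"
  obtains r where "ds_realizable ds r" "\<And>r'. ds_realizable ds r' \<Longrightarrow> r \<le> r'"
proof -
  define n where "n = Suc (length ds)"
  have n: "n > 0" by (simp add: n_def)
  define \<rho> :: "(nat \<times> nat \<Rightarrow> real) \<Rightarrow> real" where "\<rho> = (\<lambda>f. \<Sum>j<n. f (0, j))"
  \<comment> \<open>Matrices are encoded as functions on all index pairs, so that compactness of the
    box is Tychonoff's theorem.\<close>
  define K :: "(nat \<times> nat \<Rightarrow> real) set" where "K = (\<Pi>\<^sub>E p\<in>UNIV. {0..b})"
  \<comment> \<open>The polynomial identity is stated pointwise in \<open>z\<close>: each instance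
    is a closed condition on \<open>f\<close>, and closedness survives arbitrary
    intersections.\<close>
  define P where "P = (\<lambda>f. (\<forall>i<n. (\<Sum>j<n. f (i, j)) = \<rho> f) \<and> (\<forall>j<n. (\<Sum>i<n. f (i, j)) = \<rho> f) \<and>
     (\<forall>d\<in>set ds. \<bar>d\<bar> \<le> \<rho> f) \<and>
     (\<forall>z. det (mat n n (\<lambda>(i, j). (if i = j then z else 0) - f (i, j))) = (\<Prod>d\<leftarrow>\<rho> f # ds. z - d)))"
  \<comment> \<open>Real polynomials that agree at every point are equal, so the pointwise form
    loses nothing.\<close>
  have P_iff: "P f \<longleftrightarrow> (\<forall>i<n. (\<Sum>j<n. f (i, j)) = \<rho> f) \<and> (\<forall>j<n. (\<Sum>i<n. f (i, j)) = \<rho> f) \<and>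
     (\<forall>d\<in>set ds. \<bar>d\<bar> \<le> \<rho> f) \<and> char_poly (mat n n f) = (\<Prod>d\<leftarrow>\<rho> f # ds. [:- d, 1:])" for f
  proof -
    have "det (mat n n (\<lambda>(i, j). (if i = j then z else 0) - f (i, j))) = poly (char_poly (mat n n f)) z" for z
      by (subst poly_char_poly_det [of _ n]) (auto intro!: arg_cong [of _ _ det])
    moreover have "(\<Prod>d\<leftarrow>ds. z - d) = poly (\<Prod>d\<leftarrow>ds. [:- d, 1:]) z" for z and ds :: "real list"
      by (induction ds) (auto simp: algebra_simps)
    ultimately show ?thesis
      unfolding P_def by (simp only: poly_eq_poly_eq_iff [symmetric] fun_eq_iff)
  qed
  have cont: "continuous_on UNIV (\<lambda>f::nat \<times> nat \<Rightarrow> real. f p)" for p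
    by simp
  have cont\<rho>: "continuous_on UNIV \<rho>"
    unfolding \<rho>_def by (intro continuous_intros cont)
  have "closed {f. P f}"
    unfolding P_def Ball_def prod_list.Cons list.map
    by (intro closed_Collect_conj closed_Collect_all closed_Collect_imp closed_Collect_eq
        closed_Collect_le continuous_intros cont cont\<rho> continuous_on_det_mat)
      (auto simp: case_prod_beta intro!: continuous_intros cont)
  moreover have "compact K"
    unfolding K_def compactin_euclidean_iff [symmetric] euclidean_product_topology [symmetric]
    by (simp add: compactin_PiE)
  ultimately have "compact (K \<inter> {f. P f})" by (rule compact_Int_closed [rotated])
  have KP: "ds_realizable ds (\<rho> f)" if "f \<in> K" "P f" for f
  proof -
    have "f p \<ge> 0" for p using \<open>f \<in> K\<close> by (cases p) (auto simp: K_def PiE_iff)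
    then have "doubly_stochastic n (\<rho> f) (mat n n f)"
      using \<open>P f\<close> by (simp add: P_iff doubly_stochastic_def nonneg_matrix_def)
    then show ?thesis
      using \<open>P f\<close> unfolding P_iff ds_realizable_def n_def by blast
  qed
  have PK: "\<exists>f\<in>K \<inter> {f. P f}. \<rho> f = r" if real: "ds_realizable ds r" and "r \<le> b" for r
  proof -
    obtain A where A: "doubly_stochastic n r A" "char_poly A = (\<Prod>d\<leftarrow>r # ds. [:- d, 1:])"
      and le: "\<forall>d\<in>set ds. \<bar>d\<bar> \<le> r"
      using real unfolding ds_realizable_def n_def by blast
    have Ac: "A \<in> carrier_mat n n" and nn: "\<And>i j. i < n \<Longrightarrow> j < n \<Longrightarrow> A $$ (i, j) \<ge> 0"
      and sums: "\<And>i. i < n \<Longrightarrow> (\<Sum>j<n. A $$ (i, j)) = r" "\<And>j. j < n \<Longrightarrow> (\<Sum>i<n. A $$ (i, j)) = r"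
      using A(1) by (auto simp: doubly_stochastic_def nonneg_matrix_def)
    have r: "r \<ge> 0" using doubly_stochastic_nonneg [OF A(1) n] .
    \<comment> \<open>Padding by 0 stays in the box because 0 \<le> r \<le> b; inside the block a
      nonnegative entry is at most its row sum \<open>r\<close>.\<close>
    define f where "f = (\<lambda>(i, j). if i < n \<and> j < n then A $$ (i, j) else 0)"
    have "A $$ (i, j) \<le> b" if "i < n" "j < n" for i j
    proof -
      have "A $$ (i, j) \<le> (\<Sum>j<n. A $$ (i, j))"
        using that nn by (intro member_le_sum) auto
      then show ?thesis using sums(1) [OF that(1)] \<open>r \<le> b\<close> by simp
    qed
    then have "f \<in> K" using nn r \<open>r \<le> b\<close> by (auto simp: K_def f_def PiE_iff)
    moreover have \<rho>: "\<rho> f = r" using sums(1) n by (simp add: \<rho>_def f_def)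
    moreover have "mat n n f = A" using Ac by (intro eq_matI) (auto simp: f_def)
    then have "P f" unfolding P_iff \<rho> using A(2) le sums by (simp add: f_def)
    ultimately show ?thesis by blast
  qed
  have "K \<inter> {f. P f} \<noteq> {}" using PK [OF assms] by blast
  moreover have "continuous_on (K \<inter> {f. P f}) \<rho>" using cont\<rho> continuous_on_subset by blast
  ultimately obtain f where f: "f \<in> K \<inter> {f. P f}" "\<And>g. g \<in> K \<inter> {f. P f} \<Longrightarrow> \<rho> f \<le> \<rho> g"
    using continuous_attains_inf [OF \<open>compact (K \<inter> {f. P f})\<close>] by blast
  have "\<rho> f \<le> r'" if "ds_realizable ds r'" for r'
  proof (cases "r' \<le> b")
    case True
    then show ?thesis using PK [OF that] f(2) by blast
  next
    case False
    \<comment> \<open>A value above \<open>b\<close> exceeds the minimum because \<open>b\<close>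
      itself is attained on the compact set.\<close>
    then show ?thesis using PK [OF assms] f(2) by fastforce
  qed
  with KP f(1) show thesis by (intro that [of "\<rho> f"]) auto
qed

section \<open>From the complex spectrum to the real characteristic polynomial\<close>

lemma poly_prod_linear_eq_0_iff:
  fixes z :: "'a::idom"
  shows "poly (\<Prod>d\<leftarrow>ds. [:- d, 1:]) z = 0 \<longleftrightarrow> z \<in> set ds"
  by (induction ds) auto

lemma proots_prod_linear:
  fixes ds :: "'a::idom list"
  shows "proots (\<Prod>d\<leftarrow>ds. [:- d, 1:]) = mset ds"
proof (induction ds)
  case (Cons d ds)
  have "(\<Prod>d\<leftarrow>ds. [:- d, 1:]) \<noteq> 0" by (auto simp: prod_list_zero_iff)
  then have "proots ([:- d, 1:] * (\<Prod>d\<leftarrow>ds. [:- d, 1:])) = {#d#} + mset ds"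
    by (subst proots_mult) (auto simp: Cons)
  then show ?case by simp
qed simp

lemma map_poly_of_real_prod_linear:
  "map_poly complex_of_real (\<Prod>d\<leftarrow>ds. [:- d, 1:]) = (\<Prod>d\<leftarrow>map complex_of_real ds. [:- d, 1:])"
proof -
  interpret map_poly_comm_ring_hom complex_of_real by unfold_locales auto
  show ?thesis by (induction ds) (simp_all add: hom_distribs)
qed

lemma char_poly_of_real:
  assumes "A \<in> carrier_mat n n"
  shows "char_poly (map_mat complex_of_real A) = map_poly complex_of_real (char_poly A)"
  using assms by (rule of_real_hom.char_poly_hom)

text \<open>A monic complex polynomial is determined by its multiset of roots, and the embedding of
  real into complex polynomials is injective.\<close>

lemma spectrum_mset_eq_iff:
  assumes "A \<in> carrier_mat n n"
  shows "spectrum_mset A = mset (map complex_of_real ds) \<longleftrightarrow> char_poly A = (\<Prod>d\<leftarrow>ds. [:- d, 1:])"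
proof
  assume "char_poly A = (\<Prod>d\<leftarrow>ds. [:- d, 1:])"
  then show "spectrum_mset A = mset (map complex_of_real ds)"
    by (simp only: spectrum_mset_def char_poly_of_real [OF assms] map_poly_of_real_prod_linear
        proots_prod_linear)
next
  assume s: "spectrum_mset A = mset (map complex_of_real ds)"
  let ?p = "char_poly (map_mat complex_of_real A)"
  have "map_mat complex_of_real A \<in> carrier_mat n n" using assms by simp
  then have "lead_coeff ?p = 1" using degree_monic_char_poly by blast
  then have "?p = (\<Prod>d\<in>#mset (map complex_of_real ds). [:- d, 1:])"
    using complex_poly_decompose_multiset [of ?p] s by (simp add: spectrum_mset_def)
  also have "\<dots> = map_poly complex_of_real (\<Prod>d\<leftarrow>ds. [:- d, 1:])"
    by (simp only: map_poly_of_real_prod_linear mset_map [symmetric] prod_mset_prod_list)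
  finally have "map_poly complex_of_real (char_poly A) = map_poly complex_of_real (\<Prod>d\<leftarrow>ds. [:- d, 1:])"
    by (simp only: char_poly_of_real [OF assms])
  then show "char_poly A = (\<Prod>d\<leftarrow>ds. [:- d, 1:])"
    by (simp add: poly_eq_iff coeff_map_poly)
qed

lemma perron_eigenvalue_iff:
  assumes A: "A \<in> carrier_mat n n" and cp: "char_poly A = (\<Prod>d\<leftarrow>r # ds. [:- d, 1:])"
  shows "perron_eigenvalue A r \<longleftrightarrow> r \<ge> 0 \<and> (\<forall>d\<in>set ds. \<bar>d\<bar> \<le> r)"
proof -
  have "eigenvalue (map_mat complex_of_real A) z \<longleftrightarrow> z \<in> set (map complex_of_real (r # ds))" for z
    by (subst eigenvalue_root_char_poly [of _ n])
      (use A in \<open>simp_all only: char_poly_of_real [OF A] cp map_poly_of_real_prod_linear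
        poly_prod_linear_eq_0_iff map_carrier_mat\<close>)
  then show ?thesis by (auto simp: perron_eigenvalue_def)
qed

text \<open>The all-ones vector is an eigenvector for the line sum; this puts the line sum of a
  realizing matrix into the prescribed list.\<close>

lemma doubly_stochastic_char_poly_root:
  assumes A: "doubly_stochastic n r A" and n: "n > 0"
  shows "poly (char_poly A) r = 0"
proof -
  have Ac: "A \<in> carrier_mat n n" using A by (simp add: doubly_stochastic_def)
  have row: "\<And>i. i < n \<Longrightarrow> (\<Sum>j<n. A $$ (i, j)) = r"
    using A by (simp add: doubly_stochastic_def)
  obtain q where "char_poly A = [:- r, 1:] * q"
    using char_poly_add_const [OF Ac n row] by blast
  then show ?thesis by simp
qed

lemma doubly_stochastic_0:
  assumes "doubly_stochastic n 0 A"
  shows "A = 0\<^sub>m n n"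
proof (rule eq_matI)
  fix i j assume "i < dim_row (0\<^sub>m n n :: real mat)" "j < dim_col (0\<^sub>m n n :: real mat)"
  then have ij: "i < n" "j < n" by auto
  have "\<forall>j\<in>{..<n}. A $$ (i, j) = 0"
    using assms ij(1) by (subst sum_nonneg_eq_0_iff [symmetric])
      (auto simp: doubly_stochastic_def nonneg_matrix_def)
  with ij show "A $$ (i, j) = 0\<^sub>m n n $$ (i, j)" by simp
qed (use assms in \<open>auto simp: doubly_stochastic_def\<close>)

lemma gen_doubly_stochastic_iff:
  assumes "A \<in> carrier_mat n n" "nonneg_matrix A" "n > 0"
  shows "gen_doubly_stochastic A \<longleftrightarrow> (\<exists>r. doubly_stochastic n r A)"
  using assms doubly_stochastic_nonneg [of n _ A]
  by (auto simp: gen_doubly_stochastic_def doubly_stochastic_def)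

text \<open>The issue is that the line sum \<open>s\<close> is not assumed to be the Perron
  eigenvalue \<open>r\<close>. It is a nonnegative member of the list whose tail is nonpositive, so
  \<open>s\<close> is \<open>r\<close> or 0; if it is 0, then the nonnegative matrix is zero and
  \<open>r\<close> is 0 as well.\<close>

lemma ds_realizable_iff:
  assumes neg: "\<And>d. d \<in> set ds \<Longrightarrow> d \<le> 0" and n: "n = Suc (length ds)"
  shows "(\<exists>A\<in>carrier_mat n n. gen_doubly_stochastic A \<and>
      realizable_by r (map complex_of_real ds) A) \<longleftrightarrow> ds_realizable ds r"
proof
  assume "\<exists>A\<in>carrier_mat n n. gen_doubly_stochastic A \<and> realizable_by r (map complex_of_real ds) A"
  then obtain A where A: "A \<in> carrier_mat n n" and gds: "gen_doubly_stochastic A"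
    and re: "realizable_by r (map complex_of_real ds) A" by blast
  have nn: "nonneg_matrix A" and sp: "spectrum_mset A = mset (map complex_of_real (r # ds))"
    and pe: "perron_eigenvalue A r" using re by (auto simp: realizable_by_def)
  have cp: "char_poly A = (\<Prod>d\<leftarrow>r # ds. [:- d, 1:])"
    using sp spectrum_mset_eq_iff [OF A] by blast
  have le: "r \<ge> 0" "\<forall>d\<in>set ds. \<bar>d\<bar> \<le> r" using pe perron_eigenvalue_iff [OF A cp] by auto
  obtain s where s: "doubly_stochastic n s A"
    using gds gen_doubly_stochastic_iff [OF A nn] n by auto
  have s0: "s \<ge> 0" using doubly_stochastic_nonneg [OF s] n by simp
  have "s \<in> set (r # ds)"
    using doubly_stochastic_char_poly_root [OF s] n unfolding cp poly_prod_linear_eq_0_iff by simp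
  then have "s = r \<or> s = 0" using neg s0 by fastforce
  moreover have "r = 0" if "s = 0"
  proof -
    have "A = 0\<^sub>m n n" using s that doubly_stochastic_0 by blast
    then have "char_poly A = (\<Prod>d\<leftarrow>diag_mat A. [:- d, 1:])"
      by (intro char_poly_upper_triangular [OF A]) auto
    moreover have "poly (char_poly A) r = 0" unfolding cp poly_prod_linear_eq_0_iff by simp
    ultimately have "r \<in> set (diag_mat A)" using poly_prod_linear_eq_0_iff by metis
    with \<open>A = 0\<^sub>m n n\<close> show ?thesis by (auto simp: diag_mat_def)
  qed
  ultimately have "s = r" by blast
  with s cp le show "ds_realizable ds r" unfolding ds_realizable_def n by blast
next
  assume "ds_realizable ds r"
  then obtain A where ds: "doubly_stochastic n r A" and cp: "char_poly A = (\<Prod>d\<leftarrow>r # ds. [:- d, 1:])"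
    and le: "\<forall>d\<in>set ds. \<bar>d\<bar> \<le> r" unfolding ds_realizable_def n by blast
  have A: "A \<in> carrier_mat n n" and nn: "nonneg_matrix A" using ds by (auto simp: doubly_stochastic_def)
  have "perron_eigenvalue A r"
    using perron_eigenvalue_iff [OF A cp] le doubly_stochastic_nonneg [OF ds] n by simp
  moreover have "spectrum_mset A = mset (map complex_of_real (r # ds))"
    using spectrum_mset_eq_iff [OF A] cp by blast
  ultimately have "realizable_by r (map complex_of_real ds) A"
    using A nn by (auto simp: realizable_by_def)
  moreover have "gen_doubly_stochastic A"
    using gen_doubly_stochastic_iff [OF A nn] n ds by auto
  ultimately show "\<exists>A\<in>carrier_mat n n. gen_doubly_stochastic A \<and>
      realizable_by r (map complex_of_real ds) A" using A by blast
qed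

section \<open>The threshold as the least realizable value\<close>

theorem theorem4p4:
  fixes n :: nat and lam :: "nat \<Rightarrow> real"
  assumes "n \<ge> 2"
    and "\<And>j. 2 \<le> j \<Longrightarrow> j \<le> n \<Longrightarrow> lam j \<le> 0"
    and "\<And>i j. 2 \<le> i \<Longrightarrow> i \<le> j \<Longrightarrow> j \<le> n \<Longrightarrow> lam j \<le> lam i"
  shows "\<exists>l0. is_least l0 {x :: real.
      Max ((\<lambda>j. \<bar>lam j\<bar>) ` {2..n}) \<le> x \<and> x \<le> real (n - 1) * \<bar>lam n\<bar> \<and>
      (\<forall>l1 :: real.
         (\<exists>A \<in> carrier_mat n n. gen_doubly_stochastic A \<and>
            realizable_by l1 (map (\<lambda>j. complex_of_real (lam j)) [2..<Suc n]) A) \<longleftrightarrow> l1 \<ge> x)}"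
proof -
  define ds where "ds = map lam [2..<Suc n]"
  have len: "n = Suc (length ds)" using assms(1) by (simp add: ds_def)
  have setds: "set ds = lam ` {2..n}" by (auto simp: ds_def)
  have map: "map (\<lambda>j. complex_of_real (lam j)) [2..<Suc n] = map complex_of_real ds"
    by (simp add: ds_def)
  have neg: "d \<le> 0" if "d \<in> set ds" for d using that assms(2) by (auto simp: setds)
  \<comment> \<open>The list is nonpositive and decreasing, so its last entry has the largest
    modulus and supplies the \<mu> of \<open>ds_realizable_upper\<close>.\<close>
  have "- \<bar>lam n\<bar> \<le> d \<and> d \<le> 0" if "d \<in> set ds" for d
    using that neg assms(2) [of n] assms(3) [of _ n] assms(1) by (fastforce simp: setds)
  moreover have "ds \<noteq> []" using assms(1) by (simp add: ds_def)
  ultimately have "ds_realizable ds (real (length ds) * \<bar>lam n\<bar>)"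
    by (rule ds_realizable_upper)
  moreover have "length ds = n - 1" using len by simp
  ultimately have upper: "ds_realizable ds (real (n - 1) * \<bar>lam n\<bar>)" by simp
  obtain r where r: "ds_realizable ds r" "\<And>r'. ds_realizable ds r' \<Longrightarrow> r \<le> r'"
    using ds_realizable_least [OF upper] by blast
  have iff: "ds_realizable ds l1 \<longleftrightarrow> l1 \<ge> r" for l1
    using r ds_realizable_mono by blast
  have "Max ((\<lambda>j. \<bar>lam j\<bar>) ` {2..n}) \<le> r"
    using r(1) assms(1) by (subst Max_le_iff) (auto simp: ds_realizable_def setds)
  moreover have "(\<exists>A \<in> carrier_mat n n. gen_doubly_stochastic A \<and>
      realizable_by l1 (map complex_of_real ds) A) \<longleftrightarrow> l1 \<ge> r" for l1
    using ds_realizable_iff [OF neg len, of l1] iff by simp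
  \<comment> \<open>The witness is \<open>r\<close>. Any \<open>x\<close> satisfying the equivalence
    is itself realizable, by taking \<open>l1\<close> to be \<open>x\<close>, and is therefore at
    least \<open>r\<close>.\<close>
  ultimately show ?thesis
    using r(2) [OF upper] unfolding map is_least_def by (intro exI [of _ r]) simp
qed

end
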